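(* Let $\mathbb{D}=\{z\in\mathbb{C}:|z|<1\}$, let $E$ be a countable subset of $\mathbb{T}=\{z\in\mathbb{C}:|z|=1\}$, and fix $\zeta_0\in\mathbb{D}$. Then the set of all $f\in\mathcal{H}ol(\mathbb{D})$ such that for every $k\in\mathbb{Z}$ and every $z\in E$ the function $f^{(k)}$ is unbounded on the radius $[0,z)=\{tz: 0\le t<1\}$ is a dense $G_\delta$ set in $\mathcal{H}ol(\mathbb{D})$.
   Context: $\mathcal{H}ol(\mathbb{D})$ is the space of all holomorphic functions on $\mathbb{D}$ with the topology of uniform convergence on compact subsets of $\mathbb{D}$. A $G_\delta$ set is a countable intersection of open sets. For $f\in\mathcal{H}ol(\mathbb{D})$ define $T^{(1)}(f)(z)=\int_{\gamma_z}f(\xi)\,d\xi$, where $\gamma_z$ is any polygonal line in $\mathbb{D}$ from $\zeta_0$ to $z$, and $T^{(k)}(f)(z)=\int_{\gamma_z}T^{(k-1)}(f)(\xi)\,d\xi$ for $k\ge2$. For $k\in\mathbb{Z}$, $f^{(k)}$ denotes the $k$-th derivative of $f$ if $k>0$, $f$ itself if $k=0$, and the anti-derivative $T^{(-k)}(f)$ if $k<0$. *)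

theory Defs
  imports "HOL-Complex_Analysis.Complex_Analysis"
begin

abbreviation unit_disc :: "complex set" ("\<D>")
  where "\<D> \<equiv> ball 0 1"

text \<open>
  HOL functions are total. Fixing the value outside the disc (\<open>extensional\<close>) makes two
  elements of \<open>Hol\<close> equal exactly when they agree on the disc.
\<close>

definition Hol :: "(complex \<Rightarrow> complex) set"
  where "Hol = {f. f holomorphic_on \<D>} \<inter> extensional \<D>"

definition Hol_nbhd :: "(complex \<Rightarrow> complex) \<Rightarrow> complex set \<Rightarrow> real \<Rightarrow> (complex \<Rightarrow> complex) set"
  where "Hol_nbhd f K \<epsilon> = {g \<in> Hol. \<forall>z\<in>K. dist (g z) (f z) < \<epsilon>}"

definition Hol_topology :: "(complex \<Rightarrow> complex) topology"
  where "Hol_topology = topology (\<lambda>U. U \<subseteq> Hol \<and>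
     (\<forall>f\<in>U. \<exists>K \<epsilon>. compact K \<and> K \<subseteq> \<D> \<and> \<epsilon> > 0 \<and> Hol_nbhd f K \<epsilon> \<subseteq> U))"

lemma openin_Hol_topology:
  "openin Hol_topology U \<longleftrightarrow> U \<subseteq> Hol \<and>
     (\<forall>f\<in>U. \<exists>K \<epsilon>. compact K \<and> K \<subseteq> \<D> \<and> \<epsilon> > 0 \<and> Hol_nbhd f K \<epsilon> \<subseteq> U)"
proof -
  let ?L = "\<lambda>U. U \<subseteq> Hol \<and>
     (\<forall>f\<in>U. \<exists>K \<epsilon>. compact K \<and> K \<subseteq> \<D> \<and> \<epsilon> > 0 \<and> Hol_nbhd f K \<epsilon> \<subseteq> U)"
  have "istopology ?L"
    unfolding istopology_def
  proof (intro conjI allI impI)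
    fix S T assume S: "?L S" and T: "?L T"
    show "S \<inter> T \<subseteq> Hol" using S by blast
    show "\<forall>f\<in>S \<inter> T. \<exists>K \<epsilon>. compact K \<and> K \<subseteq> \<D> \<and> \<epsilon> > 0 \<and> Hol_nbhd f K \<epsilon> \<subseteq> S \<inter> T"
    proof
      fix f assume f: "f \<in> S \<inter> T"
      from f S obtain K \<epsilon> where 1: "compact K" "K \<subseteq> \<D>" "\<epsilon> > 0" "Hol_nbhd f K \<epsilon> \<subseteq> S"
        by (metis IntD1)
      from f T obtain L \<delta> where 2: "compact L" "L \<subseteq> \<D>" "\<delta> > 0" "Hol_nbhd f L \<delta> \<subseteq> T"
        by (metis IntD2)
      have "Hol_nbhd f (K \<union> L) (min \<epsilon> \<delta>) \<subseteq> Hol_nbhd f K \<epsilon> \<inter> Hol_nbhd f L \<delta>"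
        by (auto simp: Hol_nbhd_def)
      with 1 2 have "compact (K \<union> L) \<and> K \<union> L \<subseteq> \<D> \<and> min \<epsilon> \<delta> > 0 \<and>
          Hol_nbhd f (K \<union> L) (min \<epsilon> \<delta>) \<subseteq> S \<inter> T"
        using compact_Un by auto
      then show "\<exists>K \<epsilon>. compact K \<and> K \<subseteq> \<D> \<and> \<epsilon> > 0 \<and> Hol_nbhd f K \<epsilon> \<subseteq> S \<inter> T"
        by blast
    qed
  next
    fix \<K> assume *: "\<forall>K\<in>\<K>. ?L K"
    then show "\<Union>\<K> \<subseteq> Hol" by blast
    show "\<forall>f\<in>\<Union>\<K>. \<exists>K \<epsilon>. compact K \<and> K \<subseteq> \<D> \<and> \<epsilon> > 0 \<and> Hol_nbhd f K \<epsilon> \<subseteq> \<Union>\<K>"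
      using * by (meson Sup_upper UnionE order_trans)
  qed
  then show ?thesis
    by (simp add: Hol_topology_def)
qed

lemma topspace_Hol_topology [simp]: "topspace Hol_topology = Hol"
proof -
  have "openin Hol_topology Hol"
    unfolding openin_Hol_topology
  proof (intro conjI ballI order_refl)
    fix f assume "f \<in> Hol"
    show "\<exists>K \<epsilon>. compact K \<and> K \<subseteq> \<D> \<and> \<epsilon> > 0 \<and> Hol_nbhd f K \<epsilon> \<subseteq> Hol"
      by (rule exI[of _ "{}"]) (auto simp: Hol_nbhd_def intro!: exI[of _ 1])
  qed
  then show ?thesis
    by (metis openin_Hol_topology openin_subset openin_topspace subset_antisym)
qed

lemma openin_Hol_nbhd:
  assumes "f \<in> Hol" "compact K" "K \<subseteq> \<D>"
  shows "openin Hol_topology (Hol_nbhd f K \<epsilon>)"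
  unfolding openin_Hol_topology
proof (intro conjI ballI)
  show "Hol_nbhd f K \<epsilon> \<subseteq> Hol" by (auto simp: Hol_nbhd_def)
  fix g assume g: "g \<in> Hol_nbhd f K \<epsilon>"
  show "\<exists>L \<delta>. compact L \<and> L \<subseteq> \<D> \<and> \<delta> > 0 \<and> Hol_nbhd g L \<delta> \<subseteq> Hol_nbhd f K \<epsilon>"
  proof (cases "K = {}")
    case True
    then have "Hol_nbhd g {} 1 \<subseteq> Hol_nbhd f K \<epsilon>"
      by (auto simp: Hol_nbhd_def)
    then show ?thesis
      by (metis compact_empty empty_subsetI zero_less_one)
  next
    case False
    have "f holomorphic_on \<D>" "g holomorphic_on \<D>"
      using assms g by (auto simp: Hol_nbhd_def Hol_def)
    then have "continuous_on K f" "continuous_on K g"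
      using assms by (meson continuous_on_subset holomorphic_on_imp_continuous_on)+
    then have "continuous_on K (\<lambda>z. dist (g z) (f z))"
      by (intro continuous_intros)
    then obtain w where w: "w \<in> K" "\<And>z. z \<in> K \<Longrightarrow> dist (g z) (f z) \<le> dist (g w) (f w)"
      using continuous_attains_sup[OF \<open>compact K\<close> False] by blast
    have "dist (g w) (f w) < \<epsilon>" using g w by (auto simp: Hol_nbhd_def)
    moreover have "Hol_nbhd g K (\<epsilon> - dist (g w) (f w)) \<subseteq> Hol_nbhd f K \<epsilon>"
    proof
      fix h assume h: "h \<in> Hol_nbhd g K (\<epsilon> - dist (g w) (f w))"
      have "dist (h z) (f z) < \<epsilon>" if "z \<in> K" for z
      proof -
        have "dist (h z) (g z) < \<epsilon> - dist (g w) (f w)" using h that by (auto simp: Hol_nbhd_def)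
        then show ?thesis using w(2)[OF that] dist_triangle[of "h z" "f z" "g z"] by linarith
      qed
      then show "h \<in> Hol_nbhd f K \<epsilon>" using h by (auto simp: Hol_nbhd_def)
    qed
    ultimately show ?thesis
      using assms by (intro exI[of _ K] exI[of _ "\<epsilon> - dist (g w) (f w)"]) auto
  qed
qed

lemma limitin_Hol_topology:
  "limitin Hol_topology F f net \<longleftrightarrow>
     f \<in> Hol \<and> (\<forall>\<^sub>F n in net. F n \<in> Hol) \<and>
     (\<forall>K. compact K \<and> K \<subseteq> \<D> \<longrightarrow> uniform_limit K F f net)"
proof (intro iffI conjI allI impI)
  assume L: "limitin Hol_topology F f net"
  then show f: "f \<in> Hol" by (simp add: limitin_def)
  show "\<forall>\<^sub>F n in net. F n \<in> Hol"
    using L openin_topspace[of Hol_topology] by (auto simp: limitin_def)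
  fix K :: "complex set" assume K: "compact K \<and> K \<subseteq> \<D>"
  show "uniform_limit K F f net"
    unfolding uniform_limit_iff
  proof (intro allI impI)
    fix e :: real assume "e > 0"
    then have "f \<in> Hol_nbhd f K e" using f by (auto simp: Hol_nbhd_def)
    then have "\<forall>\<^sub>F n in net. F n \<in> Hol_nbhd f K e"
      using L openin_Hol_nbhd[OF f] K by (auto simp: limitin_def)
    then show "\<forall>\<^sub>F n in net. \<forall>x\<in>K. dist (F n x) (f x) < e"
      by (rule eventually_mono) (auto simp: Hol_nbhd_def)
  qed
next
  assume R: "f \<in> Hol \<and> (\<forall>\<^sub>F n in net. F n \<in> Hol) \<and>
     (\<forall>K. compact K \<and> K \<subseteq> \<D> \<longrightarrow> uniform_limit K F f net)"
  show "limitin Hol_topology F f net"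
    unfolding limitin_def
  proof (intro conjI allI impI)
    show "f \<in> topspace Hol_topology" using R by simp
    fix U assume "openin Hol_topology U \<and> f \<in> U"
    then obtain K \<epsilon> where K: "compact K" "K \<subseteq> \<D>" "\<epsilon> > 0" "Hol_nbhd f K \<epsilon> \<subseteq> U"
      unfolding openin_Hol_topology by blast
    then have "\<forall>\<^sub>F n in net. \<forall>x\<in>K. dist (F n x) (f x) < \<epsilon>"
      using R by (auto simp: uniform_limit_iff)
    moreover have "\<forall>\<^sub>F n in net. F n \<in> Hol" using R by blast
    ultimately show "\<forall>\<^sub>F n in net. F n \<in> U"
      by eventually_elim (use K in \<open>auto simp: Hol_nbhd_def\<close>)
  qed
qed

text \<open>
  The polygonal line used is the segment from \<open>\<zeta>0\<close> to \<open>z\<close>; by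
  \<open>contour_integral_eq_antideriv\<close> below, any other path in the disc gives the same value.
  Values at points outside the disc are meaningless and are never used.
\<close>

definition antideriv :: "complex \<Rightarrow> (complex \<Rightarrow> complex) \<Rightarrow> complex \<Rightarrow> complex"
  where "antideriv \<zeta>0 f = (\<lambda>z. contour_integral (linepath \<zeta>0 z) f)"

lemma contour_integral_eq_antideriv:
  assumes "f holomorphic_on \<D>" "valid_path \<gamma>" "path_image \<gamma> \<subseteq> \<D>"
    and "pathstart \<gamma> = \<zeta>0" "pathfinish \<gamma> = z"
  shows "contour_integral \<gamma> f = antideriv \<zeta>0 f z"
proof -
  obtain g where g: "\<And>x. x \<in> \<D> \<Longrightarrow> (g has_field_derivative f x) (at x within \<D>)"
    using holomorphic_convex_primitive'[of \<D> f] assms(1) by auto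
  have "\<zeta>0 \<in> \<D>" "z \<in> \<D>"
    using assms pathstart_in_path_image[of \<gamma>] pathfinish_in_path_image[of \<gamma>] by blast+
  then have seg: "path_image (linepath \<zeta>0 z) \<subseteq> \<D>"
    by (simp add: closed_segment_subset)
  have "(f has_contour_integral (g z - g \<zeta>0)) \<gamma>"
    using contour_integral_primitive[of \<D> g f \<gamma>, OF g] assms by auto
  moreover have "(f has_contour_integral (g z - g \<zeta>0)) (linepath \<zeta>0 z)"
    using contour_integral_primitive[of \<D> g f "linepath \<zeta>0 z", OF g] seg by auto
  ultimately show ?thesis
    unfolding antideriv_def by (metis contour_integral_unique)
qed

definition iter_deriv :: "complex \<Rightarrow> int \<Rightarrow> (complex \<Rightarrow> complex) \<Rightarrow> complex \<Rightarrow> complex"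
  where "iter_deriv \<zeta>0 k f =
    (if k \<ge> 0 then (deriv ^^ nat k) f else (antideriv \<zeta>0 ^^ nat (- k)) f)"

definition radius :: "complex \<Rightarrow> complex set"
  where "radius z = {of_real t * z | t. 0 \<le> t \<and> t < 1}"

end

(* The set is a countable intersection of the sets of all f such that f^(k) exceeds n somewhere
   on [0,z). These are open, since evaluating f^(k) at a point is continuous (Cauchy's inequality
   for k >= 0; integration enlarges bounds at most by a factor 2 for k < 0). They are dense: if
   f^(k) is bounded on the radius, add a small multiple of a function g with g^(k) unbounded there.
   For k >= 0 one takes the Cauchy kernel phi(w) = 1/(1 - conj(z) w), because a function with
   bounded derivative on the radius is bounded there; for k = -m one takes g = phi^(m), as
   m-fold integration recovers phi up to a bounded function. Baire's argument with nested
   neighbourhoods finishes the proof. *)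
theory Submission
  imports Defs
begin

section \<open>Iterated derivatives and antiderivatives\<close>

lemma antideriv_eq_primitive:
  assumes "\<And>x. x \<in> \<D> \<Longrightarrow> (g has_field_derivative f x) (at x within \<D>)"
    and "\<zeta>0 \<in> \<D>" "z \<in> \<D>"
  shows "antideriv \<zeta>0 f z = g z - g \<zeta>0"
proof -
  have "path_image (linepath \<zeta>0 z) \<subseteq> \<D>"
    using assms by (simp add: closed_segment_subset)
  then have "(f has_contour_integral (g z - g \<zeta>0)) (linepath \<zeta>0 z)"
    using contour_integral_primitive[of \<D> g f "linepath \<zeta>0 z"] assms(1) by auto
  then show ?thesis
    unfolding antideriv_def by (rule contour_integral_unique)
qed

lemma antideriv_deriv:
  assumes "\<phi> holomorphic_on \<D>" "\<zeta>0 \<in> \<D>" "z \<in> \<D>"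
  shows "antideriv \<zeta>0 (deriv \<phi>) z = \<phi> z - \<phi> \<zeta>0"
  using assms
  by (intro antideriv_eq_primitive)
     (auto intro: holomorphic_derivI[OF _ open_ball] has_field_derivative_at_within)

text \<open>A primitive \<open>g\<close> of \<open>f\<close> exists because the disc is convex;
  \<open>antideriv\<close> differs from it by the constant \<open>g \<zeta>0\<close> and inherits
  its holomorphy.\<close>

lemma holomorphic_antideriv:
  assumes "f holomorphic_on \<D>" "\<zeta>0 \<in> \<D>"
  shows "antideriv \<zeta>0 f holomorphic_on \<D>"
proof -
  obtain g where g: "\<And>x. x \<in> \<D> \<Longrightarrow> (g has_field_derivative f x) (at x within \<D>)"
    using holomorphic_convex_primitive'[of \<D> f] assms(1) by auto
  then have "g holomorphic_on \<D>"
    unfolding holomorphic_on_def field_differentiable_def by blast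
  then have "(\<lambda>z. g z - g \<zeta>0) holomorphic_on \<D>"
    by (intro holomorphic_intros)
  then show ?thesis
    by (rule holomorphic_transform) (rule antideriv_eq_primitive[OF g assms(2), symmetric])
qed

text \<open>The integral sees only the segment, which convexity keeps in the disc. This permits
  rewriting the integrand by identities that hold on the disc only.\<close>

lemma antideriv_cong:
  assumes "\<And>w. w \<in> \<D> \<Longrightarrow> f w = g w" "\<zeta>0 \<in> \<D>" "z \<in> \<D>"
  shows "antideriv \<zeta>0 f z = antideriv \<zeta>0 g z"
  unfolding antideriv_def
  using assms closed_segment_subset[of \<zeta>0 \<D> z] by (intro contour_integral_eq) auto

lemma contour_integrable_linepath_disc:
  assumes "f holomorphic_on \<D>" "\<zeta>0 \<in> \<D>" "z \<in> \<D>"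
  shows "f contour_integrable_on linepath \<zeta>0 z"
  using assms closed_segment_subset[of \<zeta>0 \<D> z]
  by (intro contour_integrable_holomorphic_simple[OF assms(1)]) auto

lemma antideriv_linear:
  assumes "f holomorphic_on \<D>" "g holomorphic_on \<D>" "\<zeta>0 \<in> \<D>" "z \<in> \<D>"
  shows "antideriv \<zeta>0 (\<lambda>w. f w + c * g w) z = antideriv \<zeta>0 f z + c * antideriv \<zeta>0 g z"
  using assms unfolding antideriv_def
  by (simp add: contour_integral_add contour_integral_lmul contour_integrable_linepath_disc
      contour_integrable_lmul)

text \<open>The factor 2 bounds the length of the segment. A general convex \<open>L\<close> serves
  two uses: a compact disc for continuity of evaluation, and \<open>\<D>\<close> itself for
  boundedness on the whole disc.\<close>

lemma norm_antideriv_le: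
  assumes "f holomorphic_on \<D>" and L: "convex L" "L \<subseteq> \<D>" "\<zeta>0 \<in> L" "z \<in> L"
    and B: "\<And>w. w \<in> L \<Longrightarrow> norm (f w) \<le> B"
  shows "norm (antideriv \<zeta>0 f z) \<le> 2 * B"
proof -
  have B0: "0 \<le> B" using order_trans[OF norm_ge_zero B[OF L(3)]] .
  have seg: "closed_segment \<zeta>0 z \<subseteq> L"
    using L by (simp add: closed_segment_subset)
  have "norm (antideriv \<zeta>0 f z) \<le> B * norm (z - \<zeta>0)"
    unfolding antideriv_def
    by (rule contour_integral_bound_linepath)
       (use assms seg B0 in \<open>auto intro!: contour_integrable_linepath_disc\<close>)
  also have "\<dots> \<le> B * 2"
  proof (rule mult_left_mono[OF _ B0])
    have "norm z < 1" "norm \<zeta>0 < 1" using L by auto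
    then show "norm (z - \<zeta>0) \<le> 2" using norm_triangle_ineq4[of z \<zeta>0] by linarith
  qed
  finally show ?thesis by (simp add: mult.commute)
qed

section \<open>Iterates of the antiderivative\<close>

lemma holomorphic_funpow_antideriv:
  assumes "f holomorphic_on \<D>" "\<zeta>0 \<in> \<D>"
  shows "(antideriv \<zeta>0 ^^ m) f holomorphic_on \<D>"
  by (induction m) (use assms in \<open>auto intro: holomorphic_antideriv\<close>)

lemma funpow_antideriv_cong:
  assumes "\<And>w. w \<in> \<D> \<Longrightarrow> f w = g w" "\<zeta>0 \<in> \<D>" "z \<in> \<D>"
  shows "(antideriv \<zeta>0 ^^ m) f z = (antideriv \<zeta>0 ^^ m) g z"
  using assms(3)
  by (induction m arbitrary: z) (use assms in \<open>auto intro: antideriv_cong\<close>)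

lemma funpow_antideriv_linear:
  assumes "f holomorphic_on \<D>" "g holomorphic_on \<D>" "\<zeta>0 \<in> \<D>" "z \<in> \<D>"
  shows "(antideriv \<zeta>0 ^^ m) (\<lambda>w. f w + c * g w) z =
    (antideriv \<zeta>0 ^^ m) f z + c * (antideriv \<zeta>0 ^^ m) g z"
  using assms(4)
proof (induction m arbitrary: z)
  case (Suc m)
  \<comment> \<open>The induction hypothesis is available on the disc only, so it enters through
    \<open>antideriv_cong\<close>.\<close>
  have "(antideriv \<zeta>0 ^^ Suc m) (\<lambda>w. f w + c * g w) z =
      antideriv \<zeta>0 (\<lambda>w. (antideriv \<zeta>0 ^^ m) f w + c * (antideriv \<zeta>0 ^^ m) g w) z"
    by (simp, rule antideriv_cong) (use Suc assms in auto)
  also have "\<dots> = (antideriv \<zeta>0 ^^ Suc m) f z + c * (antideriv \<zeta>0 ^^ Suc m) g z"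
    by (simp, rule antideriv_linear) (use assms Suc.prems in \<open>auto intro: holomorphic_funpow_antideriv\<close>)
  finally show ?case .
qed simp

lemma norm_funpow_antideriv_le:
  assumes "f holomorphic_on \<D>" and L: "convex L" "L \<subseteq> \<D>" "\<zeta>0 \<in> L" "z \<in> L"
    and B: "\<And>w. w \<in> L \<Longrightarrow> norm (f w) \<le> B"
  shows "norm ((antideriv \<zeta>0 ^^ m) f z) \<le> 2 ^ m * B"
  using L(4)
proof (induction m arbitrary: z)
  case (Suc m)
  have "norm (antideriv \<zeta>0 ((antideriv \<zeta>0 ^^ m) f) z) \<le> 2 * (2 ^ m * B)"
    by (rule norm_antideriv_le[OF _ L(1-3)])
       (use Suc assms in \<open>auto intro: holomorphic_funpow_antideriv\<close>)
  then show ?case by simp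
qed (use B in auto)

section \<open>Derivatives of integer order: locality, linearity, continuity of evaluation\<close>

lemma iter_deriv_cong:
  assumes "f holomorphic_on \<D>" "\<And>w. w \<in> \<D> \<Longrightarrow> f w = g w" "\<zeta>0 \<in> \<D>" "z \<in> \<D>"
  shows "iter_deriv \<zeta>0 k f z = iter_deriv \<zeta>0 k g z"
proof -
  have "g holomorphic_on \<D>"
    using assms by (auto intro: holomorphic_transform)
  with assms show ?thesis
    unfolding iter_deriv_def
    by (auto intro: funpow_antideriv_cong higher_deriv_transform_within_open[OF _ _ open_ball])
qed

lemma iter_deriv_linear:
  assumes "f holomorphic_on \<D>" "g holomorphic_on \<D>" "\<zeta>0 \<in> \<D>" "z \<in> \<D>"
  shows "iter_deriv \<zeta>0 k (\<lambda>w. f w + c * g w) z = iter_deriv \<zeta>0 k f z + c * iter_deriv \<zeta>0 k g z"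
proof -
  have "(\<lambda>w. c * g w) holomorphic_on \<D>"
    using assms by (intro holomorphic_intros)
  with assms show ?thesis
    unfolding iter_deriv_def
    by (auto simp: funpow_antideriv_linear higher_deriv_cmult[OF _ _ open_ball]
        higher_deriv_add[OF _ _ open_ball])
qed

text \<open>Together with linearity this says that evaluating the \<open>k\<close>-th derivative at
  \<open>w\<close> is continuous on \<open>Hol\<close>. What matters is that \<open>L\<close> and
  \<open>C\<close> do not depend on \<open>h\<close>.\<close>

lemma iter_deriv_bound_compact:
  assumes "\<zeta>0 \<in> \<D>" "w \<in> \<D>"
  obtains L C where "compact L" "L \<subseteq> \<D>" "C > 0"
    "\<And>h B. h holomorphic_on \<D> \<Longrightarrow> (\<And>z. z \<in> L \<Longrightarrow> norm (h z) \<le> B) \<Longrightarrow>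
       norm (iter_deriv \<zeta>0 k h w) \<le> C * B"
proof (cases "k \<ge> 0")
  case True
  obtain r where r: "r > 0" "cball w r \<subseteq> \<D>"
    using assms(2) open_contains_cball[THEN iffD1, OF open_ball] by blast
  show ?thesis
  proof (rule that[of "cball w r" "fact (nat k) / r ^ nat k"])
    fix h B assume h: "h holomorphic_on \<D>" and B: "\<And>z. z \<in> cball w r \<Longrightarrow> norm (h z) \<le> B"
    have "norm ((deriv ^^ nat k) h w) \<le> fact (nat k) * B / r ^ nat k"
    proof (rule Cauchy_inequality)
      have "h holomorphic_on cball w r" using h r holomorphic_on_subset by blast
      then show "continuous_on (cball w r) h" "h holomorphic_on ball w r"
        by (auto intro: holomorphic_on_imp_continuous_on holomorphic_on_subset ball_subset_cball)
    qed (use r B in \<open>auto simp: dist_norm\<close>)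
    then show "norm (iter_deriv \<zeta>0 k h w) \<le> fact (nat k) / r ^ nat k * B"
      using True by (simp add: iter_deriv_def)
  qed (use r in auto)
next
  case False
  \<comment> \<open>The integrals start at \<open>\<zeta>0\<close>, so a disc around
    \<open>w\<close> may be too small; this one, centred at 0, is convex and contains both end
    points.\<close>
  define \<rho> where "\<rho> = max (norm w) (norm \<zeta>0)"
  show ?thesis
  proof (rule that[of "cball 0 \<rho>" "2 ^ nat (- k)"])
    fix h B assume h: "h holomorphic_on \<D>" and B: "\<And>z. z \<in> cball 0 \<rho> \<Longrightarrow> norm (h z) \<le> B"
    have "norm ((antideriv \<zeta>0 ^^ nat (- k)) h w) \<le> 2 ^ nat (- k) * B"
      by (rule norm_funpow_antideriv_le[of h "cball 0 \<rho>"])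
         (use h B assms in \<open>auto simp: \<rho>_def\<close>)
    then show "norm (iter_deriv \<zeta>0 k h w) \<le> 2 ^ nat (- k) * B"
      using False by (simp add: iter_deriv_def)
  qed (use assms in \<open>auto simp: \<rho>_def\<close>)
qed

section \<open>A function whose derivative of given order is unbounded on a radius\<close>

lemma radius_subset_disc:
  assumes "norm z = 1" shows "radius z \<subseteq> \<D>"
  using assms by (auto simp: radius_def norm_mult)

lemma convex_radius: "convex (radius z)"
proof -
  have "radius z = (\<lambda>t. t *\<^sub>R z) ` {0..<1}"
    by (auto simp: radius_def scaleR_conv_of_real)
  then show ?thesis
    by (simp add: convex_linear_image[OF linear_scale_left])
qed

text \<open>Mean value inequality from the point 0: the radius is convex and each of its points has
  norm below 1.\<close>

lemma bounded_radius_if_bounded_deriv: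
  assumes "\<phi> holomorphic_on \<D>" "norm z = 1" "bounded (deriv \<phi> ` radius z)"
  shows "bounded (\<phi> ` radius z)"
proof -
  obtain B where B: "\<And>w. w \<in> radius z \<Longrightarrow> norm (deriv \<phi> w) \<le> B"
    using assms(3) by (auto simp: bounded_iff)
  have 0: "0 \<in> radius z"
    by (auto simp: radius_def intro!: exI[of _ 0])
  then have "0 \<le> B" using order_trans[OF norm_ge_zero B] by blast
  have "norm (\<phi> w) \<le> B + norm (\<phi> 0)" if w: "w \<in> radius z" for w
  proof -
    have "norm (\<phi> w - \<phi> 0) \<le> B * norm (w - 0)"
    proof (rule field_differentiable_bound[OF convex_radius[of z] _ B w 0])
      fix u assume "u \<in> radius z"
      then have "u \<in> \<D>" using radius_subset_disc[OF assms(2)] by blast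
      then show "(\<phi> has_field_derivative deriv \<phi> u) (at u within radius z)"
        by (rule holomorphic_derivI[OF assms(1) open_ball, THEN has_field_derivative_at_within])
    qed
    also have "\<dots> \<le> B * 1"
      using subsetD[OF radius_subset_disc[OF assms(2)] w] \<open>0 \<le> B\<close>
      by (intro mult_left_mono) auto
    finally show ?thesis
      using norm_triangle_sub[of "\<phi> w" "\<phi> 0"] by linarith
  qed
  then show ?thesis by (auto simp: bounded_iff)
qed

lemma unbounded_higher_deriv:
  assumes "\<phi> holomorphic_on \<D>" "norm z = 1" "\<not> bounded (\<phi> ` radius z)"
  shows "\<not> bounded ((deriv ^^ m) \<phi> ` radius z)"
proof (induction m)
  case (Suc m)
  then show ?case
    using bounded_radius_if_bounded_deriv[of "(deriv ^^ m) \<phi>" z] assms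
      holomorphic_higher_deriv[OF assms(1) open_ball] by auto
qed (use assms in auto)

text \<open>Each integration undoes one derivative up to a constant, and the further integrations of
  that constant stay bounded on the disc.\<close>

lemma bounded_funpow_antideriv_higher_deriv:
  assumes "\<phi> holomorphic_on \<D>" "\<zeta>0 \<in> \<D>"
  shows "\<exists>C. \<forall>w\<in>\<D>. norm ((antideriv \<zeta>0 ^^ m) ((deriv ^^ m) \<phi>) w - \<phi> w) \<le> C"
proof (induction m)
  case (Suc m)
  then obtain C where C: "\<And>w. w \<in> \<D> \<Longrightarrow> norm ((antideriv \<zeta>0 ^^ m) ((deriv ^^ m) \<phi>) w - \<phi> w) \<le> C"
    by blast
  define \<psi> where "\<psi> = (deriv ^^ m) \<phi>"
  have \<psi>: "\<psi> holomorphic_on \<D>"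
    unfolding \<psi>_def using assms by (intro holomorphic_higher_deriv) auto
  have "norm ((antideriv \<zeta>0 ^^ Suc m) ((deriv ^^ Suc m) \<phi>) w - \<phi> w) \<le> C + norm (\<psi> \<zeta>0) * 2 ^ m"
    if w: "w \<in> \<D>" for w
  proof -
    \<comment> \<open>The innermost integration is split off, so that it meets the outermost
      derivative and yields \<open>\<psi>\<close> minus \<open>\<psi> \<zeta>0\<close>.\<close>
    have "(antideriv \<zeta>0 ^^ Suc m) ((deriv ^^ Suc m) \<phi>) w =
        (antideriv \<zeta>0 ^^ m) (antideriv \<zeta>0 (deriv \<psi>)) w"
      by (simp add: \<psi>_def funpow_swap1)
    \<comment> \<open>The constant is written as a multiple of the function 1 to match
      \<open>funpow_antideriv_linear\<close>.\<close>
    also have "\<dots> = (antideriv \<zeta>0 ^^ m) (\<lambda>u. \<psi> u + (- \<psi> \<zeta>0) * 1) w"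
      by (rule funpow_antideriv_cong) (use antideriv_deriv[OF \<psi>] assms w in auto)
    also have "\<dots> = (antideriv \<zeta>0 ^^ m) \<psi> w + (- \<psi> \<zeta>0) * (antideriv \<zeta>0 ^^ m) (\<lambda>_. 1) w"
      using \<psi> assms w by (intro funpow_antideriv_linear) auto
    finally have eq: "(antideriv \<zeta>0 ^^ Suc m) ((deriv ^^ Suc m) \<phi>) w - \<phi> w =
        ((antideriv \<zeta>0 ^^ m) \<psi> w - \<phi> w) - \<psi> \<zeta>0 * (antideriv \<zeta>0 ^^ m) (\<lambda>_. 1) w"
      by simp
    have "norm ((antideriv \<zeta>0 ^^ m) (\<lambda>_. 1) w) \<le> 2 ^ m * 1"
      using assms w by (intro norm_funpow_antideriv_le[of _ \<D>]) auto
    then have "norm (\<psi> \<zeta>0 * (antideriv \<zeta>0 ^^ m) (\<lambda>_. 1) w) \<le> norm (\<psi> \<zeta>0) * 2 ^ m"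
      unfolding norm_mult by (intro mult_left_mono) auto
    moreover have "norm ((antideriv \<zeta>0 ^^ m) \<psi> w - \<phi> w) \<le> C"
      using C[OF w] by (simp add: \<psi>_def)
    ultimately show ?thesis
      unfolding eq by (intro order_trans[OF norm_triangle_ineq4 add_mono])
  qed
  then show ?case by blast
qed (auto intro: exI[of _ 0])

text \<open>A function at bounded distance from an unbounded one is unbounded.\<close>

lemma unbounded_funpow_antideriv_higher_deriv:
  assumes "\<phi> holomorphic_on \<D>" "\<zeta>0 \<in> \<D>" "norm z = 1" "\<not> bounded (\<phi> ` radius z)"
  shows "\<not> bounded ((antideriv \<zeta>0 ^^ m) ((deriv ^^ m) \<phi>) ` radius z)"
proof
  assume "bounded ((antideriv \<zeta>0 ^^ m) ((deriv ^^ m) \<phi>) ` radius z)"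
  then obtain B where B: "\<And>w. w \<in> radius z \<Longrightarrow> norm ((antideriv \<zeta>0 ^^ m) ((deriv ^^ m) \<phi>) w) \<le> B"
    by (auto simp: bounded_iff)
  obtain C where C: "\<And>w. w \<in> \<D> \<Longrightarrow> norm ((antideriv \<zeta>0 ^^ m) ((deriv ^^ m) \<phi>) w - \<phi> w) \<le> C"
    using bounded_funpow_antideriv_higher_deriv[OF assms(1,2)] by blast
  have "norm (\<phi> w) \<le> B + C" if "w \<in> radius z" for w
  proof -
    have "w \<in> \<D>" using that radius_subset_disc[OF assms(3)] by blast
    with B[OF that] C show ?thesis
      using norm_triangle_sub[of "\<phi> w" "(antideriv \<zeta>0 ^^ m) ((deriv ^^ m) \<phi>) w"]
      by (fastforce simp: norm_minus_commute)
  qed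
  with assms(4) show False by (auto simp: bounded_iff)
qed

text \<open>Since \<open>cnj z * z = 1\<close>, the kernel takes the value
  \<open>1 / (1 - t)\<close> at the point \<open>t * z\<close>.\<close>

lemma unbounded_Cauchy_kernel:
  assumes "norm z = 1"
  shows "\<not> bounded ((\<lambda>w. 1 / (1 - cnj z * w)) ` radius z)"
proof
  assume "bounded ((\<lambda>w. 1 / (1 - cnj z * w)) ` radius z)"
  then obtain B where "B > 0" and B: "\<And>w. w \<in> radius z \<Longrightarrow> norm (1 / (1 - cnj z * w)) \<le> B"
    by (auto simp: bounded_pos)
  \<comment> \<open>Solves \<open>1 / (1 - t) = B + 1\<close>, which beats the supposed bound
    \<open>B\<close>.\<close>
  define t where "t = 1 - 1 / (B + 1)"
  have t: "0 \<le> t" "t < 1" using \<open>B > 0\<close> by (auto simp: t_def field_simps)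
  have "cnj z * z = 1" using assms complex_norm_square[of z] by (simp add: mult.commute)
  then have "1 - cnj z * (of_real t * z) = of_real (1 - t)"
    by (simp add: mult.left_commute)
  then have "norm (1 / (1 - cnj z * (of_real t * z))) = B + 1"
    using \<open>B > 0\<close> by (simp only: norm_divide norm_of_real) (simp add: t_def)
  moreover have "of_real t * z \<in> radius z"
    using t by (auto simp: radius_def)
  ultimately show False using B by fastforce
qed

lemma exists_unbounded_iter_deriv:
  assumes "\<zeta>0 \<in> \<D>" "norm z = 1"
  obtains g where "g holomorphic_on \<D>" "\<not> bounded (iter_deriv \<zeta>0 k g ` radius z)"
proof -
  define \<phi> where "\<phi> = (\<lambda>w. 1 / (1 - cnj z * w))"
  \<comment> \<open>The pole lies on the unit circle: \<open>cnj z * w\<close> has the norm of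
    \<open>w\<close>, which is below 1.\<close>
  have "cnj z * w \<noteq> 1" if "w \<in> \<D>" for w
  proof
    assume "cnj z * w = 1"
    then have "norm (cnj z * w) = 1" by simp
    with assms that show False by (simp add: norm_mult)
  qed
  then have hol: "\<phi> holomorphic_on \<D>"
    unfolding \<phi>_def by (intro holomorphic_intros) force
  have unb: "\<not> bounded (\<phi> ` radius z)"
    unfolding \<phi>_def using assms(2) by (rule unbounded_Cauchy_kernel)
  show ?thesis
  proof (cases "k \<ge> 0")
    case True
    then show ?thesis
      using that[of \<phi>] unbounded_higher_deriv[OF hol assms(2) unb] hol
      by (auto simp: iter_deriv_def)
  next
    case False
    then show ?thesis
      using that[of "(deriv ^^ nat (- k)) \<phi>"] hol
        unbounded_funpow_antideriv_higher_deriv[OF hol assms unb]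
      by (auto simp: iter_deriv_def holomorphic_higher_deriv)
  qed
qed

section \<open>The sets of functions exceeding a bound on a radius\<close>

text \<open>The strict inequality makes these sets open; natural numbers as bounds keep the family
  countable.\<close>

definition exceeds :: "complex \<Rightarrow> complex \<Rightarrow> int \<Rightarrow> nat \<Rightarrow> (complex \<Rightarrow> complex) set"
  where "exceeds \<zeta>0 z k n = {f \<in> Hol. \<exists>w\<in>radius z. norm (iter_deriv \<zeta>0 k f w) > real n}"

lemma not_bounded_iff_exceeds:
  assumes "f \<in> Hol"
  shows "\<not> bounded (iter_deriv \<zeta>0 k f ` radius z) \<longleftrightarrow> (\<forall>n. f \<in> exceeds \<zeta>0 z k n)"
proof
  assume "\<not> bounded (iter_deriv \<zeta>0 k f ` radius z)"
  then show "\<forall>n. f \<in> exceeds \<zeta>0 z k n"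
    using assms by (auto simp: exceeds_def bounded_iff not_le)
next
  assume ex: "\<forall>n. f \<in> exceeds \<zeta>0 z k n"
  show "\<not> bounded (iter_deriv \<zeta>0 k f ` radius z)"
  proof
    assume "bounded (iter_deriv \<zeta>0 k f ` radius z)"
    then obtain B where "\<And>w. w \<in> radius z \<Longrightarrow> norm (iter_deriv \<zeta>0 k f w) \<le> B"
      by (auto simp: bounded_iff)
    moreover obtain n where "B < real n" using reals_Archimedean2 by blast
    moreover obtain w where "w \<in> radius z" "real n < norm (iter_deriv \<zeta>0 k f w)"
      using ex by (auto simp: exceeds_def)
    ultimately show False by fastforce
  qed
qed

text \<open>The point \<open>w\<close> that witnesses the excess for \<open>f\<close> still does so
  for every \<open>g\<close> near \<open>f\<close>, by continuity of evaluation at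
  \<open>w\<close>.\<close>

lemma openin_exceeds:
  assumes "\<zeta>0 \<in> \<D>" "norm z = 1"
  shows "openin Hol_topology (exceeds \<zeta>0 z k n)"
  unfolding openin_Hol_topology
proof (intro conjI ballI)
  show "exceeds \<zeta>0 z k n \<subseteq> Hol" by (auto simp: exceeds_def)
  fix f assume "f \<in> exceeds \<zeta>0 z k n"
  then obtain w where f: "f \<in> Hol" and w: "w \<in> radius z" "norm (iter_deriv \<zeta>0 k f w) > real n"
    by (auto simp: exceeds_def)
  have wD: "w \<in> \<D>" using w radius_subset_disc[OF assms(2)] by blast
  obtain L C where L: "compact L" "L \<subseteq> \<D>" "C > 0"
    and C: "\<And>h B. h holomorphic_on \<D> \<Longrightarrow> (\<And>z. z \<in> L \<Longrightarrow> norm (h z) \<le> B) \<Longrightarrow>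
       norm (iter_deriv \<zeta>0 k h w) \<le> C * B"
    using iter_deriv_bound_compact[OF assms(1) wD, of k] by blast
  \<comment> \<open>With this choice \<open>C * \<epsilon>\<close> is half of the margin by which
    \<open>f\<close> exceeds \<open>n\<close> at \<open>w\<close>.\<close>
  define \<epsilon> where "\<epsilon> = (norm (iter_deriv \<zeta>0 k f w) - real n) / (2 * C)"
  have \<epsilon>: "\<epsilon> > 0" using w L by (simp add: \<epsilon>_def)
  have "g \<in> exceeds \<zeta>0 z k n" if g: "g \<in> Hol_nbhd f L \<epsilon>" for g
  proof -
    have hol: "f holomorphic_on \<D>" "g holomorphic_on \<D>" and gH: "g \<in> Hol"
      using f g by (auto simp: Hol_def Hol_nbhd_def)
    \<comment> \<open>The difference \<open>g - f\<close> is written with the scalar -1 so that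
      \<open>iter_deriv_linear\<close> applies.\<close>
    have "norm (iter_deriv \<zeta>0 k (\<lambda>u. g u + (-1) * f u) w) \<le> C * \<epsilon>"
      using hol g by (intro C holomorphic_intros) (auto simp: Hol_nbhd_def dist_norm intro: less_imp_le)
    then have "norm (iter_deriv \<zeta>0 k g w - iter_deriv \<zeta>0 k f w) \<le> C * \<epsilon>"
      by (simp only: iter_deriv_linear[OF hol(2,1) assms(1) wD]) simp
    also have "C * \<epsilon> < norm (iter_deriv \<zeta>0 k f w) - real n"
      using w L by (simp add: \<epsilon>_def)
    finally have "real n < norm (iter_deriv \<zeta>0 k g w)"
      using norm_triangle_sub[of "iter_deriv \<zeta>0 k f w" "iter_deriv \<zeta>0 k g w"]
      by (simp add: norm_minus_commute)
    then show ?thesis using gH w by (auto simp: exceeds_def)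
  qed
  then show "\<exists>K \<epsilon>. compact K \<and> K \<subseteq> \<D> \<and> \<epsilon> > 0 \<and> Hol_nbhd f K \<epsilon> \<subseteq> exceeds \<zeta>0 z k n"
    using L \<epsilon> by blast
qed

text \<open>If \<open>f\<close> itself does not exceed \<open>n\<close>, its derivative is bounded
  by \<open>n\<close> on the radius, and adding a small multiple of an unbounded example leads out
  of that bound.\<close>

lemma dense_exceeds:
  assumes "\<zeta>0 \<in> \<D>" "norm z = 1" "openin Hol_topology V" "V \<noteq> {}"
  shows "exceeds \<zeta>0 z k n \<inter> V \<noteq> {}"
proof -
  obtain f where f: "f \<in> V" using assms(4) by blast
  then have fH: "f \<in> Hol"
    using openin_subset[OF assms(3)] by auto
  then have holf: "f holomorphic_on \<D>"
    by (simp add: Hol_def)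
  obtain K \<epsilon> where K: "compact K" "K \<subseteq> \<D>" "\<epsilon> > 0" "Hol_nbhd f K \<epsilon> \<subseteq> V"
    using f assms(3) unfolding openin_Hol_topology by blast
  show ?thesis
  proof (cases "f \<in> exceeds \<zeta>0 z k n")
    case False
    then have fle: "\<And>w. w \<in> radius z \<Longrightarrow> norm (iter_deriv \<zeta>0 k f w) \<le> real n"
      using fH by (auto simp: exceeds_def not_less)
    obtain g where holg: "g holomorphic_on \<D>" and g: "\<not> bounded (iter_deriv \<zeta>0 k g ` radius z)"
      using exists_unbounded_iter_deriv[OF assms(1,2)] by blast
    have "compact (g ` K)"
      using K holg by (meson compact_continuous_image continuous_on_subset holomorphic_on_imp_continuous_on)
    then obtain M where M: "M > 0" "\<And>w. w \<in> K \<Longrightarrow> norm (g w) \<le> M"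
      using compact_imp_bounded[of "g ` K"] by (auto simp: bounded_pos)
    \<comment> \<open>As \<open>g\<close> is bounded by \<open>M\<close> on \<open>K\<close>, the
      perturbation has size at most \<open>\<epsilon> / 2\<close> there.\<close>
    define \<delta> where "\<delta> = \<epsilon> / (2 * M)"
    have \<delta>: "\<delta> > 0" "\<delta> * M < \<epsilon>" using K M by (auto simp: \<delta>_def)
    \<comment> \<open>Restriction puts the sum into \<open>Hol\<close>, whose members have a fixed
      value outside the disc.\<close>
    define h where "h = restrict (\<lambda>w. f w + of_real \<delta> * g w) \<D>"
    have hol: "(\<lambda>w. f w + of_real \<delta> * g w) holomorphic_on \<D>"
      using holf holg by (intro holomorphic_intros)
    then have "h holomorphic_on \<D>"
      by (rule holomorphic_transform) (simp add: h_def)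
    then have hH: "h \<in> Hol" by (simp add: Hol_def h_def)
    have "dist (h w) (f w) < \<epsilon>" if "w \<in> K" for w
    proof -
      have "dist (h w) (f w) = \<delta> * norm (g w)"
        using that K \<delta> by (auto simp: h_def dist_norm norm_mult)
      also have "\<dots> \<le> \<delta> * M" using M(2)[OF that] \<delta> by simp
      finally show ?thesis using \<delta> by simp
    qed
    then have "h \<in> V" using hH K by (auto simp: Hol_nbhd_def)
    \<comment> \<open>Twice \<open>n\<close>, because the contribution of \<open>f\<close> may
      cancel as much as \<open>n\<close>.\<close>
    obtain w where w: "w \<in> radius z" "norm (iter_deriv \<zeta>0 k g w) > 2 * real n / \<delta>"
      using g by (force simp: bounded_iff not_le)
    have wD: "w \<in> \<D>" using w radius_subset_disc[OF assms(2)] by blast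
    have "iter_deriv \<zeta>0 k h w = iter_deriv \<zeta>0 k (\<lambda>w. f w + of_real \<delta> * g w) w"
      by (rule iter_deriv_cong[OF hol _ assms(1) wD, symmetric]) (simp add: h_def)
    also have "\<dots> = iter_deriv \<zeta>0 k f w + of_real \<delta> * iter_deriv \<zeta>0 k g w"
      by (rule iter_deriv_linear[OF holf holg assms(1) wD])
    finally have eq: "of_real \<delta> * iter_deriv \<zeta>0 k g w = iter_deriv \<zeta>0 k h w - iter_deriv \<zeta>0 k f w"
      by simp
    have "2 * real n < \<delta> * norm (iter_deriv \<zeta>0 k g w)"
      using w \<delta> by (simp add: field_simps)
    also have "\<dots> = norm (iter_deriv \<zeta>0 k h w - iter_deriv \<zeta>0 k f w)"
      using \<delta> by (simp flip: eq add: norm_mult)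
    also have "\<dots> \<le> norm (iter_deriv \<zeta>0 k h w) + norm (iter_deriv \<zeta>0 k f w)"
      by (rule norm_triangle_ineq4)
    finally have "real n < norm (iter_deriv \<zeta>0 k h w)"
      using fle[OF w(1)] by linarith
    with hH w \<open>h \<in> V\<close> show ?thesis by (auto simp: exceeds_def)
  qed (use f in blast)
qed

section \<open>The Baire property of the space of holomorphic functions\<close>

lemma compact_subset_disc:
  assumes "compact K" "K \<subseteq> \<D>"
  obtains \<rho> where "\<rho> < 1" "K \<subseteq> cball 0 \<rho>"
proof (cases "K = {}")
  case False
  obtain x where "x \<in> K" "\<And>y. y \<in> K \<Longrightarrow> norm y \<le> norm x"
    using continuous_attains_sup[OF assms(1) False, of norm] by (auto intro: continuous_intros)
  moreover from this have "norm x < 1" using assms(2) by auto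
  ultimately show ?thesis by (intro that[of "norm x"]) auto
qed (use that[of 0] in auto)

text \<open>The closed counterpart of \<open>Hol_nbhd\<close>: the weak inequality survives
  pointwise limits.\<close>

definition Hol_cnbhd :: "(complex \<Rightarrow> complex) \<Rightarrow> real \<Rightarrow> real \<Rightarrow> (complex \<Rightarrow> complex) set"
  where "Hol_cnbhd f r \<epsilon> = {g \<in> Hol. \<forall>z\<in>cball 0 r. dist (g z) (f z) \<le> \<epsilon>}"

lemma Hol_cnbhd_in_open:
  assumes "openin Hol_topology W" "f \<in> W" "\<delta> > 0"
  obtains r \<epsilon> where "1 - \<delta> \<le> r" "r < 1" "0 < \<epsilon>" "\<epsilon> \<le> \<delta>" "Hol_cnbhd f r \<epsilon> \<subseteq> W"
proof -
  obtain K \<epsilon> where K: "compact K" "K \<subseteq> \<D>" "\<epsilon> > 0" "Hol_nbhd f K \<epsilon> \<subseteq> W"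
    using assms(1,2) unfolding openin_Hol_topology by blast
  obtain \<rho> where \<rho>: "\<rho> < 1" "K \<subseteq> cball 0 \<rho>"
    using compact_subset_disc K by blast
  show ?thesis
  \<comment> \<open>The maximum makes the disc contain \<open>K\<close> and come within
    \<open>\<delta>\<close> of the unit circle; halving \<open>\<epsilon>\<close> turns the weak
    inequality into the strict one.\<close>
  proof (rule that[of "max \<rho> (1 - \<delta>)" "min \<delta> (\<epsilon> / 2)"])
    have "dist (g z) (f z) < \<epsilon>"
      if g: "g \<in> Hol_cnbhd f (max \<rho> (1 - \<delta>)) (min \<delta> (\<epsilon> / 2))" and "z \<in> K" for g z
    proof -
      have "z \<in> cball 0 (max \<rho> (1 - \<delta>))" using \<open>z \<in> K\<close> \<rho> by auto
      then have "dist (g z) (f z) \<le> min \<delta> (\<epsilon> / 2)" using g unfolding Hol_cnbhd_def by blast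
      then show ?thesis using \<open>\<epsilon> > 0\<close> by linarith
    qed
    then have "Hol_cnbhd f (max \<rho> (1 - \<delta>)) (min \<delta> (\<epsilon> / 2)) \<subseteq> Hol_nbhd f K \<epsilon>"
      by (auto simp: Hol_cnbhd_def Hol_nbhd_def)
    then show "Hol_cnbhd f (max \<rho> (1 - \<delta>)) (min \<delta> (\<epsilon> / 2)) \<subseteq> W"
      using K by blast
  qed (use K \<rho> assms in auto)
qed

text \<open>Completeness of \<open>Hol\<close>: radii tend to 1 and tolerances to 0, so the centres
  converge uniformly on smaller discs. The limit is holomorphic by Weierstrass' theorem and inherits
  every closed bound.\<close>

lemma Hol_nested_cnbhds:
  assumes F: "\<And>n. F n \<in> Hol" and r: "\<And>n. 1 - inverse (real (Suc n)) \<le> r n" "\<And>n. r n < 1"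
    and \<epsilon>: "\<And>n. \<epsilon> n \<le> inverse (real (Suc n))"
    and nest: "\<And>m n. n \<le> m \<Longrightarrow> F m \<in> Hol_cnbhd (F n) (r n) (\<epsilon> n)"
  obtains g where "\<And>n. g \<in> Hol_cnbhd (F n) (r n) (\<epsilon> n)"
proof -
  define g where "g = restrict (\<lambda>w. lim (\<lambda>n. F n w)) \<D>"
  have ul: "uniform_limit (cball 0 \<rho>) F g sequentially" if "\<rho> < 1" for \<rho>
  proof -
    have "uniformly_Cauchy_on (cball 0 \<rho>) F"
      unfolding uniformly_Cauchy_on_def
    proof (intro allI impI)
      fix e :: real assume "e > 0"
      with \<open>\<rho> < 1\<close> have "min (e / 2) (1 - \<rho>) > 0" by simp
      \<comment> \<open>One \<open>N\<close> meets two demands: the disc of radius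
        \<open>r N\<close> covers \<open>cball 0 \<rho>\<close>, and
        \<open>2 * \<epsilon> N < e\<close>.\<close>
      then obtain N where N: "inverse (real (Suc N)) < min (e / 2) (1 - \<rho>)"
        using reals_Archimedean by blast
      have "dist (F m w) (F n w) < e" if "w \<in> cball 0 \<rho>" "N \<le> m" "N \<le> n" for m n w
      proof -
        have w: "w \<in> cball 0 (r N)" using that N r(1)[of N] by auto
        have "dist (F m w) (F N w) \<le> \<epsilon> N" "dist (F n w) (F N w) \<le> \<epsilon> N"
          using nest[OF that(2)] nest[OF that(3)] w by (auto simp: Hol_cnbhd_def)
        then have "dist (F m w) (F n w) \<le> 2 * \<epsilon> N"
          using dist_triangle2[of "F m w" "F n w" "F N w"] by linarith
        also have "\<dots> < e" using \<epsilon>[of N] N by auto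
        finally show ?thesis .
      qed
      then show "\<exists>M. \<forall>x\<in>cball 0 \<rho>. \<forall>m\<ge>M. \<forall>n\<ge>M. dist (F m x) (F n x) < e"
        by blast
    qed
    then have "uniform_limit (cball 0 \<rho>) F (\<lambda>w. lim (\<lambda>n. F n w)) sequentially"
      by (intro uniformly_convergent_uniform_limit_iff[THEN iffD1] Cauchy_uniformly_convergent)
    also have "?this \<longleftrightarrow> ?thesis"
      using \<open>\<rho> < 1\<close> by (intro uniform_limit_cong') (auto simp: g_def)
    finally show ?thesis .
  qed
  have "g holomorphic_on \<D>"
  proof (rule holomorphic_uniform_sequence[of _ F])
    show "F n holomorphic_on \<D>" for n using F by (auto simp: Hol_def)
    fix x :: complex assume "x \<in> \<D>"
    then obtain d where d: "d > 0" "cball x d \<subseteq> \<D>"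
      using open_contains_cball[THEN iffD1, OF open_ball] by blast
    obtain \<rho> where \<rho>: "\<rho> < 1" "cball x d \<subseteq> cball 0 \<rho>"
      using compact_subset_disc[OF compact_cball d(2)] by blast
    show "\<exists>d>0. cball x d \<subseteq> \<D> \<and> uniform_limit (cball x d) F g sequentially"
      using d uniform_limit_on_subset[OF ul[OF \<rho>(1)] \<rho>(2)] by blast
  qed simp
  then have gH: "g \<in> Hol" by (simp add: Hol_def g_def)
  show ?thesis
  proof (rule that)
    fix n
    have "dist (g w) (F n w) \<le> \<epsilon> n" if w: "w \<in> cball 0 (r n)" for w
    \<comment> \<open>From index \<open>n\<close> on, all centres satisfy the bound at
      \<open>w\<close>, and it passes to the limit.\<close>
    proof (rule tendsto_upperbound)
      show "(\<lambda>m. dist (F m w) (F n w)) \<longlonglongrightarrow> dist (g w) (F n w)"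
        by (intro tendsto_intros tendsto_uniform_limitI[OF ul[OF r(2)] w])
      show "\<forall>\<^sub>F m in sequentially. dist (F m w) (F n w) \<le> \<epsilon> n"
        using eventually_ge_at_top[of n]
        by eventually_elim (use nest w in \<open>auto simp: Hol_cnbhd_def\<close>)
    qed simp
    with gH show "g \<in> Hol_cnbhd (F n) (r n) (\<epsilon> n)" by (auto simp: Hol_cnbhd_def)
  qed
qed

lemma Hol_Baire_sequence:
  fixes U :: "nat \<Rightarrow> (complex \<Rightarrow> complex) set"
  assumes U: "\<And>n. openin Hol_topology (U n)"
    and dense: "\<And>n W. openin Hol_topology W \<Longrightarrow> W \<noteq> {} \<Longrightarrow> U n \<inter> W \<noteq> {}"
    and V: "openin Hol_topology V" "V \<noteq> {}"
  shows "(\<Inter>n. U n) \<inter> V \<noteq> {}"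
proof -
  define B where "B = (\<lambda>(f, r, \<epsilon>). Hol_cnbhd f r \<epsilon>)"
  \<comment> \<open>A triple \<open>(f, r, \<epsilon>)\<close> encodes a closed neighbourhood;
    \<open>P n\<close> demands that it lie in \<open>U n \<inter> V\<close> and be small enough for
    completeness.\<close>
  define P where "P = (\<lambda>n (f, r, \<epsilon>). f \<in> Hol \<and> 1 - inverse (real (Suc n)) \<le> r \<and> r < 1 \<and>
    0 < \<epsilon> \<and> \<epsilon> \<le> inverse (real (Suc n)) \<and> Hol_cnbhd f r \<epsilon> \<subseteq> U n \<inter> V)"
  have step: "\<exists>y. P n y \<and> B y \<subseteq> W"
    if W: "openin Hol_topology W" "W \<noteq> {}" "W \<subseteq> V" for n W
  proof -
    obtain f where f: "f \<in> U n \<inter> W" using dense[OF W(1,2)] by blast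
    have "openin Hol_topology (U n \<inter> W)" using U W(1) by (rule openin_Int)
    moreover have "inverse (real (Suc n)) > 0" by simp
    ultimately obtain r \<epsilon> where r: "1 - inverse (real (Suc n)) \<le> r" "r < 1" "0 < \<epsilon>"
        "\<epsilon> \<le> inverse (real (Suc n))" "Hol_cnbhd f r \<epsilon> \<subseteq> U n \<inter> W"
      by (rule Hol_cnbhd_in_open[OF _ f])
    have "f \<in> Hol" using f openin_subset[OF U[of n]] by auto
    with r W(3) have "P n (f, r, \<epsilon>)" "B (f, r, \<epsilon>) \<subseteq> W"
      unfolding P_def B_def by blast+
    then show ?thesis by blast
  qed
  have "\<exists>x. \<forall>n. P n (x n) \<and> B (x (Suc n)) \<subseteq> B (x n)"
  proof (rule dependent_nat_choice)
    show "\<exists>x. P 0 x" using step[OF V] by blast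
    fix x n assume "P n x"
    obtain f r \<epsilon> where x: "x = (f, r, \<epsilon>)" by (cases x)
    \<comment> \<open>The density step requires an open set, so it is applied to the open
      neighbourhood with the same data, nonempty since it contains its centre.\<close>
    let ?W = "Hol_nbhd f (cball 0 r) \<epsilon>"
    have f: "f \<in> Hol" "r < 1" "\<epsilon> > 0" "Hol_cnbhd f r \<epsilon> \<subseteq> V"
      using \<open>P n x\<close> by (auto simp: P_def x)
    have sub: "?W \<subseteq> B x" by (auto simp: Hol_nbhd_def Hol_cnbhd_def B_def x)
    moreover have "openin Hol_topology ?W"
      using f by (intro openin_Hol_nbhd) auto
    moreover have "f \<in> ?W" using f by (auto simp: Hol_nbhd_def)
    moreover have "?W \<subseteq> V" using sub f by (auto simp: B_def x)
    ultimately obtain y where "P (Suc n) y" "B y \<subseteq> ?W"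
      using step[of ?W "Suc n"] by blast
    with sub show "\<exists>y. P (Suc n) y \<and> B y \<subseteq> B x" by blast
  qed
  then obtain x where x: "\<And>n. P n (x n)" "\<And>n. B (x (Suc n)) \<subseteq> B (x n)" by blast
  define F r \<epsilon> where "F n = fst (x n)" and "r n = fst (snd (x n))" and "\<epsilon> n = snd (snd (x n))" for n
  have xn: "x n = (F n, r n, \<epsilon> n)" for n by (simp add: F_def r_def \<epsilon>_def)
  have P: "F n \<in> Hol" "1 - inverse (real (Suc n)) \<le> r n" "r n < 1" "0 < \<epsilon> n"
    "\<epsilon> n \<le> inverse (real (Suc n))" "Hol_cnbhd (F n) (r n) (\<epsilon> n) \<subseteq> U n \<inter> V" for n
    using x(1)[of n] by (auto simp: P_def xn)
  have "F m \<in> Hol_cnbhd (F n) (r n) (\<epsilon> n)" if "n \<le> m" for m n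
  proof -
    have "B (x m) \<subseteq> B (x n)" by (rule lift_Suc_antimono_le[of "\<lambda>n. B (x n)", OF x(2) that])
    moreover have "F m \<in> B (x m)" using P(1,4)[of m] by (auto simp: B_def xn Hol_cnbhd_def)
    ultimately show ?thesis by (auto simp: B_def xn)
  qed
  then obtain g where "\<And>n. g \<in> Hol_cnbhd (F n) (r n) (\<epsilon> n)"
    using Hol_nested_cnbhds[of F r \<epsilon>, OF P(1,2,3,5)] by blast
  then have "g \<in> U n \<inter> V" for n using P(6)[of n] by blast
  then show ?thesis by blast
qed

section \<open>Countable intersection over points of \<open>E\<close>, orders and bounds\<close>

theorem mainTheorem7:
  fixes E :: "complex set" and \<zeta>0 :: complex
  assumes "countable E" and "E \<subseteq> sphere 0 1" and "\<zeta>0 \<in> \<D>"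
  shows "let S = {f \<in> Hol. \<forall>k::int. \<forall>z\<in>E. \<not> bounded (iter_deriv \<zeta>0 k f ` radius z)}
         in gdelta_in Hol_topology S \<and> Hol_topology closure_of S = topspace Hol_topology"
proof -
  define S where "S = {f \<in> Hol. \<forall>k::int. \<forall>z\<in>E. \<not> bounded (iter_deriv \<zeta>0 k f ` radius z)}"
  \<comment> \<open>Inserting \<open>Hol\<close> keeps the family nonempty and its intersection
    inside \<open>Hol\<close> when \<open>E\<close> is empty.\<close>
  define \<U> where "\<U> = insert Hol ((\<lambda>(z, k, n). exceeds \<zeta>0 z k n) ` (E \<times> UNIV \<times> UNIV))"
  have \<U>: "countable \<U>" "\<U> \<noteq> {}" using assms(1) by (auto simp: \<U>_def)
  have S: "S = \<Inter>\<U>"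
  proof -
    have "S = {f \<in> Hol. \<forall>k. \<forall>z\<in>E. \<forall>n. f \<in> exceeds \<zeta>0 z k n}"
      unfolding S_def using not_bounded_iff_exceeds by blast
    then show ?thesis by (auto simp: \<U>_def)
  qed
  have opn: "openin Hol_topology U" if "U \<in> \<U>" for U
    using that assms openin_exceeds[OF assms(3)] openin_topspace[of Hol_topology]
    by (auto simp: \<U>_def)
  have dense: "U \<inter> W \<noteq> {}" if "U \<in> \<U>" "openin Hol_topology W" "W \<noteq> {}" for U W
    using that assms(2) dense_exceeds[OF assms(3) _ that(2,3)] openin_subset[OF that(2)]
    by (auto simp: \<U>_def)
  have "gdelta_in Hol_topology S"
    unfolding S using \<U> opn by (intro gdelta_in_Inter open_imp_gdelta_in)
  moreover have "Hol_topology closure_of S = topspace Hol_topology"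
    unfolding dense_intersects_open
  proof (intro allI impI, elim conjE)
    fix V assume V: "openin Hol_topology V" "V \<noteq> {}"
    \<comment> \<open>A nonempty countable family is the range of a sequence, possibly with
      repetitions, so the sequential Baire lemma applies.\<close>
    have "(\<Inter>n. from_nat_into \<U> n) \<inter> V \<noteq> {}"
      using opn dense from_nat_into[OF \<U>(2)] V by (intro Hol_Baire_sequence) auto
    then show "S \<inter> V \<noteq> {}"
      unfolding S using range_from_nat_into[OF \<U>(2,1)] by simp
  qed
  ultimately show ?thesis unfolding S_def Let_def by simp
qed

end
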